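(* Let $G$ be a competition game. An outcome $(P,\mathbf x)$ is a PSPE of the two-step game $G$ if and only if it belongs to the core of the corresponding labor market in the Kelso–Crawford model.
   Context: Competition game: $N$ is a finite set of workers, $K$ a finite set of $k\ge 2$ firms, and each firm $i\in K$ has a nondecreasing value function $v_i:2^N\to\mathbb R_+$ with $v_i(\emptyset)=0$. In step 1 all firms simultaneously choose payment policies $\mathbf x_i=(x_{ij})_{j\in N}\in\mathbb R^N$ (payments may be negative). In step 2 each worker chooses a firm or stays idle. An outcome is a pair $(P,\mathbf X)$ where $\mathbf X=(x_{ij})$ and $P=(S_0,(S_i)_{i\in K})$ is a partition of $N$ ($S_0$ = idle workers; parts may be empty). Put $x_{0j}=0$. A worker $j\in S_i$ receives $\hat x_j=x_{ij}$; firm $i$ has profit $r_i(P,\mathbf X)=v_i(S_i)-\sum_{j\in S_i}x_{ij}$. Only pure strategies are considered. PSPE: let $\mathcal P(\mathbf X)$ be the set of partitions in which every worker makes a choice giving her the highest payoff under $\mathbf X$ (being idle pays $0$), i.e. every $j\in S_i$ ($i\in K\cup\{0\}$) satisfies $x_{ij}=\max_{i'\in K\cup\{0\}}x_{i'j}$. Workers are assumed to use a known tie-breaking rule, so that the result of offering $\mathbf X$ is a unique well-defined partition $P(\mathbf X)\in\mathcal P(\mathbf X)$. An outcome $(P,\mathbf X)$ is a pure subgame perfect equilibrium (PSPE) if: (a) $P=P(\mathbf X)$; and (b) for every $i\in K$ and every policy $\mathbf x_i'$, $r_i(P',\mathbf X')\le r_i(P,\mathbf X)$, where $\mathbf X'=(\mathbf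 x_{-i},\mathbf x_i')$ and $P'=P(\mathbf X')$. For $\mathbf x\in\mathbb R^N$, the outcome $(P,\mathbf x)$ denotes the outcome $(P,\mathbf X)$ in which every firm offers $x_{ij}=x_j$ to each worker $j$, where $x_j=\hat x_j$ is the realized payment (so $x_j=0$ for idle workers). Core (Kelso–Crawford labor market with the same $N,K,(v_i)$, workers caring only about salary): $(P,\mathbf x)$, with salaries $x_j$ paid to workers, is in the core if there is no nonempty group $R=K'\cup N'$ ($K'\subseteq K$, $N'\subseteq N$) that can deviate so that all its members strictly gain, i.e. there are no disjoint subsets $(T_i)_{i\in K'}$ of $N'$ (workers of $N'$ in no $T_i$ being idle with payment $0$) and salaries $(y_j)_{j\in N'}$ (with $y_j=0$ for the idle ones) such that $y_j>x_j$ for all $j\in N'$ and $v_i(T_i)-\sum_{j\in T_i}y_j>v_i(S_i)-\sum_{j\in S_i}x_j$ for all $i\in K'$.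
   Formalization: For a fixed tie-breaking rule a core outcome need not have P = P(X), so "core implies PSPE" fails; the equivalence is stated as PSPE for some tie-breaking rule iff core, and for every rule that selects P when all firms offer x. *)

theory Defs
  imports Complex_Main "HOL-Library.FuncSet" "HOL-Library.Disjoint_Sets"
begin

locale competition_game =
  fixes N :: "'w set" and K :: "'f set" and v :: "'f \<Rightarrow> 'w set \<Rightarrow> real"
  assumes finite_workers: "finite N"
    and finite_firms: "finite K"
    and two_firms: "card K \<ge> 2"
    and value_nonneg: "\<And>i S. i \<in> K \<Longrightarrow> S \<subseteq> N \<Longrightarrow> 0 \<le> v i S"
    and value_empty: "\<And>i. i \<in> K \<Longrightarrow> v i {} = 0"
    and value_mono: "\<And>i S T. i \<in> K \<Longrightarrow> S \<subseteq> T \<Longrightarrow> T \<subseteq> N \<Longrightarrow> v i S \<le> v i T"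

text \<open>Payment policies and profiles are extensional functions, so that a profile carries
  no information beyond the payments $x_{ij}$ with $i \in K$ and $j \in N$.\<close>

definition policies :: "'w set \<Rightarrow> ('w \<Rightarrow> real) set" where
  "policies N = N \<rightarrow>\<^sub>E UNIV"

definition profiles :: "'w set \<Rightarrow> 'f set \<Rightarrow> ('f \<Rightarrow> 'w \<Rightarrow> real) set" where
  "profiles N K = K \<rightarrow>\<^sub>E policies N"

text \<open>The index set $K \cup \{0\}$, where \<^term>\<open>None\<close> plays the role of $0$ (being idle).\<close>

definition choices :: "'f set \<Rightarrow> 'f option set" where
  "choices K = insert None (Some ` K)"

text \<open>The indexed partitions $(S_0, (S_i)_{i \in K})$ of $N$, with possibly empty parts;
  extensionality makes the representation unique.\<close>

definition partitions :: "'w set \<Rightarrow> 'f set \<Rightarrow> ('f option \<Rightarrow> 'w set) set" where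
  "partitions N K = {P \<in> choices K \<rightarrow>\<^sub>E Pow N.
     disjoint_family_on P (choices K) \<and> (\<Union>c\<in>choices K. P c) = N}"

fun payment :: "('f \<Rightarrow> 'w \<Rightarrow> real) \<Rightarrow> 'f option \<Rightarrow> 'w \<Rightarrow> real" where
  "payment X None j = 0"
| "payment X (Some i) j = X i j"

definition profit ::
  "('f \<Rightarrow> 'w set \<Rightarrow> real) \<Rightarrow> ('f option \<Rightarrow> 'w set) \<Rightarrow> ('f \<Rightarrow> 'w \<Rightarrow> real) \<Rightarrow> 'f \<Rightarrow> real" where
  "profit v P X i = v i (P (Some i)) - (\<Sum>j\<in>P (Some i). X i j)"

definition optimal_partitions ::
  "'w set \<Rightarrow> 'f set \<Rightarrow> ('f \<Rightarrow> 'w \<Rightarrow> real) \<Rightarrow> ('f option \<Rightarrow> 'w set) set" where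
  "optimal_partitions N K X = {P \<in> partitions N K.
     \<forall>c\<in>choices K. \<forall>j\<in>P c. payment X c j = Max ((\<lambda>c'. payment X c' j) ` choices K)}"

definition tie_breaking_rule ::
  "'w set \<Rightarrow> 'f set \<Rightarrow> (('f \<Rightarrow> 'w \<Rightarrow> real) \<Rightarrow> 'f option \<Rightarrow> 'w set) \<Rightarrow> bool" where
  "tie_breaking_rule N K \<tau> \<longleftrightarrow> (\<forall>X\<in>profiles N K. \<tau> X \<in> optimal_partitions N K X)"

text \<open>The rule \<^term>\<open>\<tau>\<close> is a parameter: when all firms make the same offers, workers are
  indifferent between firms, so the condition \<^term>\<open>P = \<tau> X\<close> depends on the chosen rule.\<close>

definition PSPE ::
  "'w set \<Rightarrow> 'f set \<Rightarrow> ('f \<Rightarrow> 'w set \<Rightarrow> real) \<Rightarrow> (('f \<Rightarrow> 'w \<Rightarrow> real) \<Rightarrow> 'f option \<Rightarrow> 'w set) \<Rightarrow>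
   ('f option \<Rightarrow> 'w set) \<Rightarrow> ('f \<Rightarrow> 'w \<Rightarrow> real) \<Rightarrow> bool" where
  "PSPE N K v \<tau> P X \<longleftrightarrow>
     P = \<tau> X \<and>
     (\<forall>i\<in>K. \<forall>x'\<in>policies N.
        profit v (\<tau> (X(i := x'))) (X(i := x')) i \<le> profit v P X i)"

text \<open>Every firm offers $x_j$ to each worker $j$.\<close>

definition uniform_profile :: "'w set \<Rightarrow> 'f set \<Rightarrow> ('w \<Rightarrow> real) \<Rightarrow> 'f \<Rightarrow> 'w \<Rightarrow> real" where
  "uniform_profile N K x = (\<lambda>i\<in>K. \<lambda>j\<in>N. x j)"

text \<open>Pairs $(P, \mathbf x)$ in which $\mathbf x$ lists realized payments, so that idle
  workers have $x_j = 0$.\<close>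

definition salary_outcome ::
  "'w set \<Rightarrow> 'f set \<Rightarrow> ('f option \<Rightarrow> 'w set) \<Rightarrow> ('w \<Rightarrow> real) \<Rightarrow> bool" where
  "salary_outcome N K P x \<longleftrightarrow> P \<in> partitions N K \<and> (\<forall>j\<in>P None. x j = 0)"

definition blocks ::
  "('f \<Rightarrow> 'w set \<Rightarrow> real) \<Rightarrow> ('f option \<Rightarrow> 'w set) \<Rightarrow> ('w \<Rightarrow> real) \<Rightarrow>
   'f set \<Rightarrow> 'w set \<Rightarrow> ('f \<Rightarrow> 'w set) \<Rightarrow> ('w \<Rightarrow> real) \<Rightarrow> bool" where
  "blocks v P x K' N' T y \<longleftrightarrow>
     (\<forall>i\<in>K'. T i \<subseteq> N') \<and> disjoint_family_on T K' \<and>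
     (\<forall>j\<in>N' - (\<Union>i\<in>K'. T i). y j = 0) \<and>
     (\<forall>j\<in>N'. y j > x j) \<and>
     (\<forall>i\<in>K'. v i (T i) - (\<Sum>j\<in>T i. y j) > v i (P (Some i)) - (\<Sum>j\<in>P (Some i). x j))"

definition in_core ::
  "'w set \<Rightarrow> 'f set \<Rightarrow> ('f \<Rightarrow> 'w set \<Rightarrow> real) \<Rightarrow> ('f option \<Rightarrow> 'w set) \<Rightarrow> ('w \<Rightarrow> real) \<Rightarrow> bool" where
  "in_core N K v P x \<longleftrightarrow>
     \<not> (\<exists>K' N' T y. K' \<subseteq> K \<and> N' \<subseteq> N \<and> (K' \<noteq> {} \<or> N' \<noteq> {}) \<and> blocks v P x K' N' T y)"

end

(* Two firms make the same offers at a uniform profile, so a deviating firm attracts a worker j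
   only by offering at least x_j, because a competitor still offers x_j. A profitable deviation
   therefore makes the firm and its new workers a blocking group once the strict gain is shared
   through a small raise. Conversely, any firm of a blocking group can carry out its part of the
   block alone: its offers y_j exceed x_j and 0, hence attract exactly the workers it wants when
   the others are offered a negative payment. A group without firms blocks only if some x_j is
   negative, and then P is not optimal for the workers. *)

theory Submission
  imports Defs
begin

section \<open>Partitions that are optimal for the workers\<close>

lemma finite_choices: "finite K \<Longrightarrow> finite (choices K)"
  by (simp add: choices_def)

lemma partitions_cover:
  assumes "P \<in> partitions N K" "j \<in> N"
  obtains c where "c \<in> choices K" "j \<in> P c"
  using assms by (auto simp: partitions_def)

lemma partitions_subset:
  assumes "P \<in> partitions N K" "c \<in> choices K"
  shows "P c \<subseteq> N"
  using assms by (auto simp: partitions_def PiE_iff)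

lemma optimal_partitions_iff:
  assumes "finite K"
  shows "P \<in> optimal_partitions N K X \<longleftrightarrow> P \<in> partitions N K \<and>
    (\<forall>c\<in>choices K. \<forall>j\<in>P c. \<forall>c'\<in>choices K. payment X c' j \<le> payment X c j)"
proof -
  have "payment X c j = Max ((\<lambda>c'. payment X c' j) ` choices K)
      \<longleftrightarrow> (\<forall>c'\<in>choices K. payment X c' j \<le> payment X c j)" if "c \<in> choices K" for c j
    using that finite_choices[OF assms]
    by (subst eq_Max_iff) auto
  then show ?thesis
    by (auto simp: optimal_partitions_def)
qed

text \<open>Sending each worker to one fixed best choice \<open>g j\<close> is optimal. This
  supplies the values of a tie-breaking rule at profiles where nothing is prescribed.\<close>

lemma optimal_partitions_nonempty:
  assumes "finite K"
  shows "optimal_partitions N K X \<noteq> {}"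
proof -
  have "\<exists>c. is_arg_max (\<lambda>c. payment X c j) (\<lambda>c. c \<in> choices K) c" for j
  proof -
    have "Max ((\<lambda>c. payment X c j) ` choices K) \<in> (\<lambda>c. payment X c j) ` choices K"
      using finite_choices[OF assms] by (intro Max_in) (auto simp: choices_def)
    then obtain c where "c \<in> choices K" "payment X c j = Max ((\<lambda>c. payment X c j) ` choices K)"
      by auto
    then show ?thesis
      using finite_choices[OF assms] by (auto simp: is_arg_max_linorder)
  qed
  then obtain g where g: "is_arg_max (\<lambda>c. payment X c j) (\<lambda>c. c \<in> choices K) (g j)" for j
    by metis
  have "(\<lambda>c\<in>choices K. {j\<in>N. g j = c}) \<in> optimal_partitions N K X"
    unfolding optimal_partitions_iff[OF assms] partitions_def
    using g by (auto simp: is_arg_max_linorder disjoint_family_on_def)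
  then show ?thesis by blast
qed

section \<open>Uniform offers and unilateral deviations from them\<close>

lemma uniform_profile_in_profiles: "uniform_profile N K x \<in> profiles N K"
  by (auto simp: uniform_profile_def profiles_def policies_def)

lemma profiles_fun_upd:
  assumes "X \<in> profiles N K" "i \<in> K" "x' \<in> policies N"
  shows "X(i := x') \<in> profiles N K"
  using assms by (auto simp: profiles_def PiE_iff extensional_def)

lemma profit_uniform_profile:
  assumes "P \<in> partitions N K" "i \<in> K"
  shows "profit v P (uniform_profile N K x) i = v i (P (Some i)) - (\<Sum>j\<in>P (Some i). x j)"
proof -
  have "P (Some i) \<subseteq> N"
    using assms by (intro partitions_subset) (auto simp: choices_def)
  then have "(\<Sum>j\<in>P (Some i). uniform_profile N K x i j) = (\<Sum>j\<in>P (Some i). x j)"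
    using assms(2) by (intro sum.cong) (auto simp: uniform_profile_def)
  then show ?thesis
    by (simp add: profit_def)
qed

text \<open>A worker with a negative salary would block alone by becoming idle, in a group without
  firms.\<close>

lemma in_core_nonneg:
  assumes "in_core N K v P x" "j \<in> N"
  shows "0 \<le> x j"
proof (rule ccontr)
  assume "\<not> 0 \<le> x j"
  then have "blocks v P x {} {j} (\<lambda>_. {}) (\<lambda>_. 0)"
    by (auto simp: blocks_def disjoint_family_on_def)
  with assms show False
    unfolding in_core_def by blast
qed

context competition_game
begin

text \<open>Under uniform offers a worker can only get \<open>x j\<close> from a firm or 0 when
  idle, so the sole conceivable improvement is to quit a negative salary.\<close>

lemma optimal_at_uniform_profile_iff:
  assumes "salary_outcome N K P x"
  shows "P \<in> optimal_partitions N K (uniform_profile N K x) \<longleftrightarrow> (\<forall>j\<in>N. 0 \<le> x j)"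
proof -
  have P: "P \<in> partitions N K" and idle: "\<And>j. j \<in> P None \<Longrightarrow> x j = 0"
    using assms by (auto simp: salary_outcome_def)
  have pay: "payment (uniform_profile N K x) c j = (if c = None then 0 else x j)"
    if "c \<in> choices K" "j \<in> N" for c j
    using that by (auto simp: choices_def uniform_profile_def)
  \<comment> \<open>For an idle worker both sides are 0, since \<open>salary_outcome\<close> lists
    realized payments.\<close>
  have real: "payment (uniform_profile N K x) c j = x j" if "c \<in> choices K" "j \<in> P c" for c j
    using that pay[of c j] idle[of j] partitions_subset[OF P, of c] by (cases c) auto
  show ?thesis
  proof
    assume opt: "P \<in> optimal_partitions N K (uniform_profile N K x)"
    show "\<forall>j\<in>N. 0 \<le> x j"
    proof
      fix j assume "j \<in> N"
      then obtain c where c: "c \<in> choices K" "j \<in> P c"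
        using partitions_cover[OF P] by blast
      moreover have "None \<in> choices K"
        by (simp add: choices_def)
      ultimately have "payment (uniform_profile N K x) None j \<le> payment (uniform_profile N K x) c j"
        using opt unfolding optimal_partitions_iff[OF finite_firms] by blast
      then show "0 \<le> x j"
        using real[OF c] by simp
    qed
  next
    assume nonneg: "\<forall>j\<in>N. 0 \<le> x j"
    have "payment (uniform_profile N K x) c' j \<le> payment (uniform_profile N K x) c j"
      if "c \<in> choices K" "j \<in> P c" "c' \<in> choices K" for c j c'
    proof -
      have "j \<in> N"
        using partitions_subset[OF P] that by blast
      then show ?thesis
        using real[OF that(1,2)] pay[OF that(3)] nonneg by simp
    qed
    then show "P \<in> optimal_partitions N K (uniform_profile N K x)"
      using P unfolding optimal_partitions_iff[OF finite_firms] by blast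
  qed
qed

text \<open>This is where \<open>two_firms\<close> enters: when \<open>i\<close> deviates, some
  competitor still offers \<open>x j\<close> to every worker.\<close>

lemma exists_other_firm:
  assumes "i \<in> K"
  obtains i' where "i' \<in> K" "i' \<noteq> i"
proof -
  have "\<not> K \<subseteq> {i}"
    using two_firms card_mono[of "{i}" K] by auto
  then show thesis
    using that by blast
qed

text \<open>The bound covers every reaction \<open>Q\<close> that is optimal for the workers, so it
  holds under any tie-breaking rule.\<close>

lemma in_core_no_profitable_deviation:
  assumes core: "in_core N K v P x"
    and i: "i \<in> K"
    and Q: "Q \<in> optimal_partitions N K ((uniform_profile N K x)(i := x'))"
  shows "profit v Q ((uniform_profile N K x)(i := x')) i
    \<le> v i (P (Some i)) - (\<Sum>j\<in>P (Some i). x j)"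
proof (rule ccontr)
  define T where "T = Q (Some i)"
  define r where "r = v i (P (Some i)) - (\<Sum>j\<in>P (Some i). x j)"
  assume "\<not> ?thesis"
  then have gain: "v i T - (\<Sum>j\<in>T. x' j) > r"
    by (simp add: profit_def T_def r_def)
  have choice: "Some i \<in> choices K"
    using i by (simp add: choices_def)
  have TN: "T \<subseteq> N"
    using Q choice unfolding T_def optimal_partitions_def by (blast dest: partitions_subset)
  obtain i' where i': "i' \<in> K" "i' \<noteq> i"
    using exists_other_firm[OF i] .
  have "x j \<le> x' j" if "j \<in> T" for j
  proof -
    have "Some i' \<in> choices K"
      using i' by (simp add: choices_def)
    then have "payment ((uniform_profile N K x)(i := x')) (Some i') j
        \<le> payment ((uniform_profile N K x)(i := x')) (Some i) j"
      using Q choice that unfolding T_def optimal_partitions_iff[OF finite_firms] by blast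
    then show ?thesis
      using i' that TN by (auto simp: uniform_profile_def)
  qed
  then have "(\<Sum>j\<in>T. x j) \<le> (\<Sum>j\<in>T. x' j)"
    by (rule sum_mono)
  with gain have gap: "v i T - (\<Sum>j\<in>T. x j) - r > 0"
    by simp
  \<comment> \<open>The surplus is split into \<open>card T + 1\<close> shares: one for each worker
    and one kept by the firm, whose gain thus stays strict. An empty \<open>T\<close> needs no
    separate case.\<close>
  define \<epsilon> where "\<epsilon> = (v i T - (\<Sum>j\<in>T. x j) - r) / (real (card T) + 1)"
  have pos: "\<epsilon> > 0"
    using gap by (simp add: \<epsilon>_def)
  have "(real (card T) + 1) * \<epsilon> = v i T - (\<Sum>j\<in>T. x j) - r"
    by (simp add: \<epsilon>_def add_nonneg_eq_0_iff)
  then have "v i T - (\<Sum>j\<in>T. x j + \<epsilon>) > r"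
    using pos by (simp add: sum.distrib algebra_simps)
  then have "blocks v P x {i} T (\<lambda>_. T) (\<lambda>j. x j + \<epsilon>)"
    using pos by (simp add: blocks_def disjoint_family_on_def r_def)
  with core i TN show False
    unfolding in_core_def by blast
qed

text \<open>For workers in \<open>T\<close> the offer of \<open>i\<close> strictly beats both
  \<open>x j\<close> and 0; for all others, -1 is worse than being idle. No tie involves firm
  \<open>i\<close>, so every optimal reaction gives it exactly \<open>T\<close>.\<close>

lemma deviation_attracts:
  assumes nonneg: "\<And>j. j \<in> N \<Longrightarrow> 0 \<le> x j"
    and i: "i \<in> K"
    and T: "T \<subseteq> N" "\<And>j. j \<in> T \<Longrightarrow> x j < y j"
    and Q: "Q \<in> optimal_partitions N K
      ((uniform_profile N K x)(i := \<lambda>j\<in>N. if j \<in> T then y j else - 1))"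
      (is "_ \<in> optimal_partitions _ _ ?X")
  shows "Q (Some i) = T"
proof -
  have part: "Q \<in> partitions N K"
    and opt: "\<And>c c' j. c \<in> choices K \<Longrightarrow> j \<in> Q c \<Longrightarrow> c' \<in> choices K
      \<Longrightarrow> payment ?X c' j \<le> payment ?X c j"
    using Q unfolding optimal_partitions_iff[OF finite_firms] by blast+
  have choice: "Some i \<in> choices K" "None \<in> choices K"
    using i by (auto simp: choices_def)
  have "j \<in> T" if "j \<in> Q (Some i)" for j
  proof -
    have "j \<in> N"
      using partitions_subset[OF part choice(1)] that by blast
    then show ?thesis
      using opt[OF choice(1) that choice(2)] by (auto split: if_splits)
  qed
  moreover have "j \<in> Q (Some i)" if "j \<in> T" for j
  proof -
    have j: "j \<in> N" "0 \<le> x j" "x j < y j"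
      using that T nonneg by auto
    then obtain c where c: "c \<in> choices K" "j \<in> Q c"
      using partitions_cover[OF part] by blast
    have "y j \<le> payment ?X c j"
      using opt[OF c choice(1)] that j by simp
    \<comment> \<open>Any other choice pays \<open>x j\<close> or 0, both below
      \<open>y j\<close>.\<close>
    then have "c = Some i"
      using c(1) j by (auto simp: choices_def uniform_profile_def split: if_splits)
    then show ?thesis
      using c by simp
  qed
  ultimately show ?thesis
    by blast
qed

section \<open>The equivalence for a given tie-breaking rule, and the existence of a suitable
  rule\<close>

lemma PSPE_iff_in_core:
  assumes outcome: "salary_outcome N K P x"
    and tie: "tie_breaking_rule N K \<tau>"
    and tau: "\<tau> (uniform_profile N K x) = P"
  shows "PSPE N K v \<tau> P (uniform_profile N K x) \<longleftrightarrow> in_core N K v P x"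
proof -
  have P: "P \<in> partitions N K"
    using outcome by (simp add: salary_outcome_def)
  have opt_tau: "\<tau> X \<in> optimal_partitions N K X" if "X \<in> profiles N K" for X
    using tie that by (simp add: tie_breaking_rule_def)
  \<comment> \<open>A rule is constrained only on \<open>profiles N K\<close>, so the deviation must
    be seen to stay there.\<close>
  have dev: "\<tau> ((uniform_profile N K x)(i := x'))
      \<in> optimal_partitions N K ((uniform_profile N K x)(i := x'))"
    if "i \<in> K" "x' \<in> policies N" for i x'
    by (rule opt_tau[OF profiles_fun_upd[OF uniform_profile_in_profiles that]])
  show ?thesis
  proof
    assume "in_core N K v P x"
    then show "PSPE N K v \<tau> P (uniform_profile N K x)"
      unfolding PSPE_def
      using tau in_core_no_profitable_deviation dev by (simp add: profit_uniform_profile[OF P])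
  next
    assume eq: "PSPE N K v \<tau> P (uniform_profile N K x)"
    have "P \<in> optimal_partitions N K (uniform_profile N K x)"
      using opt_tau[OF uniform_profile_in_profiles] tau by metis
    then have nonneg: "0 \<le> x j" if "j \<in> N" for j
      using optimal_at_uniform_profile_iff[OF outcome] that by blast
    show "in_core N K v P x"
      unfolding in_core_def
    proof (intro notI, elim exE conjE)
      fix K' N' T y
      assume K': "K' \<subseteq> K" and N': "N' \<subseteq> N" and ne: "K' \<noteq> {} \<or> N' \<noteq> {}"
        and block: "blocks v P x K' N' T y"
      \<comment> \<open>Without firms all members of the group are idle, and gaining 0 would require
        a negative \<open>x j\<close>.\<close>
      have "K' \<noteq> {}"
      proof
        assume "K' = {}"
        then obtain j where "j \<in> N'" "y j = 0" "x j < y j"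
          using ne block by (auto simp: blocks_def)
        then show False
          using nonneg[of j] N' by auto
      qed
      then obtain i where i: "i \<in> K'"
        by blast
      then have iK: "i \<in> K" and T: "T i \<subseteq> N" "\<And>j. j \<in> T i \<Longrightarrow> x j < y j"
        and gain: "v i (T i) - (\<Sum>j\<in>T i. y j) > v i (P (Some i)) - (\<Sum>j\<in>P (Some i). x j)"
        using K' N' block unfolding blocks_def by blast+
      \<comment> \<open>The offer -1 stands for any negative payment; it keeps workers outside
        \<open>T i\<close> away.\<close>
      define x' where "x' = (\<lambda>j\<in>N. if j \<in> T i then y j else - 1)"
      have pol: "x' \<in> policies N"
        by (auto simp: x'_def policies_def)
      have "\<tau> ((uniform_profile N K x)(i := x')) (Some i) = T i"
        using dev[OF iK pol] unfolding x'_def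
        by (intro deviation_attracts[where x = x and y = y] nonneg iK T)
      moreover have "(\<Sum>j\<in>T i. x' j) = (\<Sum>j\<in>T i. y j)"
        using T(1) by (intro sum.cong) (auto simp: x'_def)
      ultimately have "profit v (\<tau> ((uniform_profile N K x)(i := x')))
          ((uniform_profile N K x)(i := x')) i > profit v P (uniform_profile N K x) i"
        using gain by (simp add: profit_uniform_profile[OF P iK]) (simp add: profit_def)
      with eq iK pol show False
        unfolding PSPE_def by (meson not_le)
    qed
  qed
qed

text \<open>An arbitrary selection of optimal partitions may be overridden at the single profile
  \<open>X\<close>, because \<open>P\<close> is itself optimal there.\<close>

lemma tie_breaking_rule_exists:
  assumes "P \<in> optimal_partitions N K X"
  obtains \<tau> where "tie_breaking_rule N K \<tau>" "\<tau> X = P"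
proof -
  define \<sigma> where "\<sigma> Y = (SOME Q. Q \<in> optimal_partitions N K Y)" for Y
  have "\<sigma> Y \<in> optimal_partitions N K Y" for Y
    using optimal_partitions_nonempty[OF finite_firms] by (simp add: \<sigma>_def some_in_eq)
  then show thesis
    using assms that[of "\<sigma>(X := P)"] by (simp add: tie_breaking_rule_def)
qed

end

theorem lemma2p2:
  fixes N :: "'w set" and K :: "'f set" and v :: "'f \<Rightarrow> 'w set \<Rightarrow> real"
    and P :: "'f option \<Rightarrow> 'w set" and x :: "'w \<Rightarrow> real"
  assumes "competition_game N K v"
    and "salary_outcome N K P x"
  shows "((\<exists>\<tau>. tie_breaking_rule N K \<tau> \<and> PSPE N K v \<tau> P (uniform_profile N K x))
            \<longleftrightarrow> in_core N K v P x)
       \<and> (\<forall>\<tau>. tie_breaking_rule N K \<tau> \<and> \<tau> (uniform_profile N K x) = P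
            \<longrightarrow> (PSPE N K v \<tau> P (uniform_profile N K x) \<longleftrightarrow> in_core N K v P x))"
proof -
  interpret competition_game N K v
    by fact
  note iff = PSPE_iff_in_core[OF assms(2)]
  have "\<exists>\<tau>. tie_breaking_rule N K \<tau> \<and> PSPE N K v \<tau> P (uniform_profile N K x)"
    if core: "in_core N K v P x"
  proof -
    \<comment> \<open>Core membership forces nonnegative salaries, which makes \<open>P\<close> a
      legitimate answer of some rule at the uniform profile.\<close>
    have "P \<in> optimal_partitions N K (uniform_profile N K x)"
      using optimal_at_uniform_profile_iff[OF assms(2)] in_core_nonneg[OF core] by blast
    then show ?thesis
      using iff core tie_breaking_rule_exists by metis
  qed
  moreover have "in_core N K v P x"
    if "tie_breaking_rule N K \<tau>" "PSPE N K v \<tau> P (uniform_profile N K x)" for \<tau>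
  proof -
    have "\<tau> (uniform_profile N K x) = P"
      using that(2) by (simp add: PSPE_def)
    then show ?thesis
      using that iff by blast
  qed
  ultimately show ?thesis
    using iff by blast
qed

end
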